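(* Let $f$, $\phi$, $h_x$, $h_u$, $h_e$, $\alpha_e,\alpha_u$, $\mu_i,\sigma_i$, and the resulting functions $a_i, r_i:\mathbb{R}^n\times\mathbb{R}^m\to\mathbb{R}$ and $b_i:\mathbb{R}^n\times\mathbb{R}^m\to\mathbb{R}^m$, $i\in\{e,u\}$, be as in the context. Then $(h_e,h_u)$ is a compatible robust ICBF pair and the quadratic program $$\min_{v\in\mathbb{R}^m}\ \|v\|^2\quad\text{s.t.}\quad b_i(x_p,u)^\top v\ \ge\ a_i(x_p,u)+r_i(x_p,u),\quad i\in\{e,u\},$$ is feasible (i.e. for every $(x_p,u)\in\mathbb{R}^n\times\mathbb{R}^m$ there exists $v\in\mathbb{R}^m$ satisfying both constraints) if and only if for all $(x_p,u)\in\mathbb{R}^n\times\mathbb{R}^m$ the following three conditions hold, with all quantities evaluated at $(x_p,u)$: (a) $b_e=0 \implies a_e\le 0$; (b) $b_u=0 \implies a_u\le 0$; (c) $\|b_e\|\,\|b_u\|+b_e^\top b_u=0 \implies (a_e+r_e)\|b_u\|+(a_u+r_u)\|b_e\|\le 0$.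
   Context: $\|\cdot\|$ is the Euclidean norm. An extended class-$\mathcal K$ function ($\alpha\in\mathcal{K}^{\rm e}$) is a continuous strictly increasing function $\alpha:(-b,a)\to\mathbb{R}$, $a,b>0$, with $\alpha(0)=0$; its domain is assumed to contain all values at which it is evaluated. Data: $f:\mathbb{R}^n\times\mathbb{R}^m\to\mathbb{R}^n$ and $\phi:\mathbb{R}^n\times\mathbb{R}^m\to\mathbb{R}^m$ are continuously differentiable (system dynamics and nominal integral controller $\dot u=\phi(x_p,u)+v$, where the state $x_p$ satisfies $\dot x_p=f(x_p,u)$). $h_x:\mathbb{R}^n\to\mathbb{R}$ and $h_u:\mathbb{R}^m\to\mathbb{R}$ are continuously differentiable, $\alpha_x\in\mathcal K^{\rm e}$, and $$h_e(x,u):=\frac{\partial h_x}{\partial x}(x)f(x,u)+\alpha_x(h_x(x))$$ is assumed continuously differentiable. $h_u$ is also regarded as a function of $(x,u)$ that does not depend on $x$. Gradients $\partial h/\partial x$, $\partial h/\partial u$ are row vectors. With $\alpha_e,\alpha_u\in\mathcal K^{\rm e}$, define for $i\in\{e,u\}$ $$b_i(x,u):=\Big(\frac{\partial h_i}{\partial u}(x,u)\Big)^\top,\qquad a_i(x,u):=-\frac{\partial h_i}{\partial x}(x,u)f(x,u)-\frac{\partial h_i}{\partial u}(x,u)\phi(x,u)-\alpha_i(h_i(x,u)),$$ (so the $x$-derivative term vanishes for $i=u$), and $$r_i(x,u):=\mu_i(h_i(x,u))\,\|b_i(x,u)\|+\sigma_i(h_i(x,u))\,\|b_i(x,u)\|^2,$$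 where $\mu_i,\sigma_i:\mathbb{R}\to\mathbb{R}_{>0}$ are continuously differentiable and monotonically decreasing. The pair $(h_e,h_u)$ is called a compatible robust ICBF (integral control barrier function) pair if for every $(x_p,u)\in\mathbb{R}^n\times\mathbb{R}^m$ there exists a single $v\in\mathbb{R}^m$ with $b_i(x_p,u)^\top v\ge a_i(x_p,u)+r_i(x_p,u)$ for both $i=e$ and $i=u$. *)

theory Defs
  imports "HOL-Analysis.Analysis"
begin

definition continuously_differentiable ::
    "('a::real_normed_vector \<Rightarrow> 'b::real_normed_vector) \<Rightarrow> bool" where
  "continuously_differentiable g \<longleftrightarrow>
     (\<exists>g' :: 'a \<Rightarrow> 'a \<Rightarrow>\<^sub>L 'b.
        (\<forall>x. (g has_derivative blinfun_apply (g' x)) (at x)) \<and> continuous_on UNIV g')"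

(* D is the domain (-b,a).  The endpoints range over the extended reals, so the unbounded
   domains (e.g. all of R) are included.  Values of alpha outside D are irrelevant. *)
definition ext_class_K_on :: "real set \<Rightarrow> (real \<Rightarrow> real) \<Rightarrow> bool" where
  "ext_class_K_on D \<alpha> \<longleftrightarrow>
     (\<exists>a b :: ereal. 0 < a \<and> 0 < b \<and> D = {s. - b < ereal s \<and> ereal s < a}) \<and>
     continuous_on D \<alpha> \<and> strict_mono_on D \<alpha> \<and> \<alpha> 0 = 0"

(* The vector of partial derivatives.  A row gradient times a column vector y is the
   inner product of gradient and y. *)
definition gradient :: "(real ^ 'k \<Rightarrow> real) \<Rightarrow> real ^ 'k \<Rightarrow> real ^ 'k" where
  "gradient g x = (\<chi> j. frechet_derivative g (at x) (axis j 1))"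

definition gradient_x ::
    "((real ^ 'n) \<times> (real ^ 'm) \<Rightarrow> real) \<Rightarrow> (real ^ 'n) \<times> (real ^ 'm) \<Rightarrow> real ^ 'n" where
  "gradient_x h = (\<lambda>(x, u). gradient (\<lambda>x'. h (x', u)) x)"

definition gradient_u ::
    "((real ^ 'n) \<times> (real ^ 'm) \<Rightarrow> real) \<Rightarrow> (real ^ 'n) \<times> (real ^ 'm) \<Rightarrow> real ^ 'm" where
  "gradient_u h = (\<lambda>(x, u). gradient (\<lambda>u'. h (x, u')) u)"

definition icbf_h_e ::
    "((real ^ 'n) \<times> (real ^ 'm) \<Rightarrow> real ^ 'n) \<Rightarrow> (real ^ 'n \<Rightarrow> real) \<Rightarrow> (real \<Rightarrow> real) \<Rightarrow>
     (real ^ 'n) \<times> (real ^ 'm) \<Rightarrow> real" where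
  "icbf_h_e f h_x \<alpha>_x = (\<lambda>(x, u). gradient h_x x \<bullet> f (x, u) + \<alpha>_x (h_x x))"

definition icbf_b ::
    "((real ^ 'n) \<times> (real ^ 'm) \<Rightarrow> real) \<Rightarrow> (real ^ 'n) \<times> (real ^ 'm) \<Rightarrow> real ^ 'm" where
  "icbf_b h p = gradient_u h p"

definition icbf_a ::
    "((real ^ 'n) \<times> (real ^ 'm) \<Rightarrow> real ^ 'n) \<Rightarrow> ((real ^ 'n) \<times> (real ^ 'm) \<Rightarrow> real ^ 'm) \<Rightarrow>
     ((real ^ 'n) \<times> (real ^ 'm) \<Rightarrow> real) \<Rightarrow> (real \<Rightarrow> real) \<Rightarrow> (real ^ 'n) \<times> (real ^ 'm) \<Rightarrow> real" where
  "icbf_a f \<phi> h \<alpha> p = - (gradient_x h p \<bullet> f p) - gradient_u h p \<bullet> \<phi> p - \<alpha> (h p)"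

definition icbf_r ::
    "((real ^ 'n) \<times> (real ^ 'm) \<Rightarrow> real) \<Rightarrow> (real \<Rightarrow> real) \<Rightarrow> (real \<Rightarrow> real) \<Rightarrow>
     (real ^ 'n) \<times> (real ^ 'm) \<Rightarrow> real" where
  "icbf_r h \<mu> \<sigma> p = \<mu> (h p) * norm (icbf_b h p) + \<sigma> (h p) * (norm (icbf_b h p))\<^sup>2"

definition compatible_robust_icbf_pair ::
    "((real ^ 'n) \<times> (real ^ 'm) \<Rightarrow> real ^ 'n) \<Rightarrow> ((real ^ 'n) \<times> (real ^ 'm) \<Rightarrow> real ^ 'm) \<Rightarrow>
     (real \<Rightarrow> real) \<Rightarrow> (real \<Rightarrow> real) \<Rightarrow> (real \<Rightarrow> real) \<Rightarrow>
     (real \<Rightarrow> real) \<Rightarrow> (real \<Rightarrow> real) \<Rightarrow> (real \<Rightarrow> real) \<Rightarrow>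
     ((real ^ 'n) \<times> (real ^ 'm) \<Rightarrow> real) \<Rightarrow> ((real ^ 'n) \<times> (real ^ 'm) \<Rightarrow> real) \<Rightarrow> bool" where
  "compatible_robust_icbf_pair f \<phi> \<alpha>_e \<mu>_e \<sigma>_e \<alpha>_u \<mu>_u \<sigma>_u h_e h_u \<longleftrightarrow>
     (\<forall>p. \<exists>v :: real ^ 'm.
        icbf_b h_e p \<bullet> v \<ge> icbf_a f \<phi> h_e \<alpha>_e p + icbf_r h_e \<mu>_e \<sigma>_e p \<and>
        icbf_b h_u p \<bullet> v \<ge> icbf_a f \<phi> h_u \<alpha>_u p + icbf_r h_u \<mu>_u \<sigma>_u p)"

(* A minimisation problem: objective function and constraint set. *)
type_synonym 'v program = "('v \<Rightarrow> real) \<times> 'v set"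

definition feasible :: "'v program \<Rightarrow> bool" where
  "feasible P \<longleftrightarrow> (\<exists>v. v \<in> snd P)"

definition icbf_qp ::
    "((real ^ 'n) \<times> (real ^ 'm) \<Rightarrow> real ^ 'n) \<Rightarrow> ((real ^ 'n) \<times> (real ^ 'm) \<Rightarrow> real ^ 'm) \<Rightarrow>
     (real \<Rightarrow> real) \<Rightarrow> (real \<Rightarrow> real) \<Rightarrow> (real \<Rightarrow> real) \<Rightarrow>
     (real \<Rightarrow> real) \<Rightarrow> (real \<Rightarrow> real) \<Rightarrow> (real \<Rightarrow> real) \<Rightarrow>
     ((real ^ 'n) \<times> (real ^ 'm) \<Rightarrow> real) \<Rightarrow> ((real ^ 'n) \<times> (real ^ 'm) \<Rightarrow> real) \<Rightarrow>
     (real ^ 'n) \<times> (real ^ 'm) \<Rightarrow> (real ^ 'm) program" where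
  "icbf_qp f \<phi> \<alpha>_e \<mu>_e \<sigma>_e \<alpha>_u \<mu>_u \<sigma>_u h_e h_u p =
     (\<lambda>v. (norm v)\<^sup>2,
      {v. icbf_b h_e p \<bullet> v \<ge> icbf_a f \<phi> h_e \<alpha>_e p + icbf_r h_e \<mu>_e \<sigma>_e p \<and>
          icbf_b h_u p \<bullet> v \<ge> icbf_a f \<phi> h_u \<alpha>_u p + icbf_r h_u \<mu>_u \<sigma>_u p})"

end

theory Submission imports Defs begin

text \<open>
  The problem is pointwise: two half-spaces \<open>p \<bullet> v \<ge> c\<close> and \<open>q \<bullet> v \<ge> d\<close> meet unless one of
  them is empty or \<open>p\<close> and \<open>q\<close> are antiparallel. Off the antiparallel case, a large multiple of the
  bisector \<open>norm q *\<^sub>R p + norm p *\<^sub>R q\<close> lies in both; in the antiparallel case this bisector vanishes,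
  and pairing it with \<open>v\<close> yields the third condition. The robustness terms vanish together with
  \<open>b_i\<close>, which turns \<open>a_i + r_i \<le> 0\<close> into \<open>a_i \<le> 0\<close> there.
\<close>

text \<open>Both diagonal terms of the expanded square equal the squared product of the norms. The
  identity turns the scalar premise of the third condition into the vanishing of a vector.\<close>

lemma norm_bisector_squared:
  fixes p q :: "'a::real_inner"
  shows "(norm (norm q *\<^sub>R p + norm p *\<^sub>R q))\<^sup>2 = 2 * norm p * norm q * (norm p * norm q + p \<bullet> q)"
proof -
  have "(norm (norm q *\<^sub>R p + norm p *\<^sub>R q))\<^sup>2
      = (norm q)\<^sup>2 * (p \<bullet> p) + 2 * norm p * norm q * (p \<bullet> q) + (norm p)\<^sup>2 * (q \<bullet> q)"
    unfolding power2_norm_eq_inner [of "norm q *\<^sub>R p + norm p *\<^sub>R q"]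
    by (simp add: inner_add inner_commute power2_eq_square algebra_simps)
  then show ?thesis
    by (simp add: dot_square_norm power2_eq_square algebra_simps)
qed

lemma two_halfspaces_intersect_iff:
  fixes p q :: "'a::real_inner" and c d :: real
  shows "(\<exists>v. p \<bullet> v \<ge> c \<and> q \<bullet> v \<ge> d) \<longleftrightarrow>
    (p = 0 \<longrightarrow> c \<le> 0) \<and> (q = 0 \<longrightarrow> d \<le> 0) \<and>
    (norm p * norm q + p \<bullet> q = 0 \<longrightarrow> c * norm q + d * norm p \<le> 0)"
    (is "?meet \<longleftrightarrow> ?cond")
proof
  assume ?meet
  then obtain v where v: "p \<bullet> v \<ge> c" "q \<bullet> v \<ge> d" by blast
  have "c * norm q + d * norm p \<le> 0" if "norm p * norm q + p \<bullet> q = 0"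
  proof -
    have "norm q *\<^sub>R p + norm p *\<^sub>R q = 0"
      using norm_bisector_squared [of q p] that by simp
    \<comment> \<open>As in Farkas' lemma, the nonnegative weights \<open>norm q\<close> and
      \<open>norm p\<close> eliminate \<open>v\<close> from the two constraints.\<close>
    then have "(p \<bullet> v) * norm q + (q \<bullet> v) * norm p = 0"
      by (metis inner_add_left inner_scaleR_left inner_zero_left mult.commute)
    moreover have "c * norm q \<le> (p \<bullet> v) * norm q" "d * norm p \<le> (q \<bullet> v) * norm p"
      using v by (auto intro: mult_right_mono)
    ultimately show ?thesis by linarith
  qed
  with v show ?cond by auto
next
  assume cond: ?cond
  consider "p = 0" | "q = 0" | "p \<noteq> 0" "q \<noteq> 0" by blast
  then show ?meet
  proof cases
    case 1
    \<comment> \<open>The foot of the perpendicular from the origin to the boundary hyperplane. If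
      \<open>q = 0\<close> as well, the witness is 0 and the claim is
      \<open>d \<le> 0\<close>.\<close>
    have "q \<bullet> ((d / (q \<bullet> q)) *\<^sub>R q) \<ge> d" using cond by (cases "q = 0") auto
    with 1 cond show ?thesis by (metis inner_zero_left)
  next
    case 2
    have "p \<bullet> ((c / (p \<bullet> p)) *\<^sub>R p) \<ge> c" using cond by (cases "p = 0") auto
    with 2 cond show ?thesis by (metis inner_zero_left)
  next
    case 3
    define s where "s = norm p * norm q + p \<bullet> q"
    have "s \<ge> 0" using Cauchy_Schwarz_ineq2 [of p q] by (auto simp: s_def)
    show ?thesis
    proof (cases "s = 0")
      case True
      \<comment> \<open>Here \<open>q\<close> is a negative multiple of \<open>p\<close>, so the
        boundaries are parallel. A point on the first boundary satisfies the second constraint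
        exactly by the third condition.\<close>
      let ?v = "(c / (p \<bullet> p)) *\<^sub>R p"
      have "p \<bullet> q = - (norm p * norm q)" using True by (simp add: s_def)
      then have "q \<bullet> ?v = - (c * norm q / norm p)"
        using 3 by (simp add: inner_commute dot_square_norm power2_eq_square)
      moreover from cond True have "c * norm q + d * norm p \<le> 0" by (simp add: s_def)
      then have "d \<le> - (c * norm q / norm p)" using 3 by (simp add: field_simps)
      ultimately have "q \<bullet> ?v \<ge> d" by linarith
      moreover have "p \<bullet> ?v \<ge> c" using 3 by simp
      ultimately show ?thesis by blast
    next
      case False
      with \<open>s \<ge> 0\<close> have "s > 0" by simp
      \<comment> \<open>The bisector has inner products \<open>norm p * s\<close> and
        \<open>norm q * s\<close> with \<open>p\<close> and \<open>q\<close>, both positive;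
        \<open>t\<close> is the least factor that meets both bounds.\<close>
      define t where "t = max (c / (norm p * s)) (d / (norm q * s))"
      let ?v = "t *\<^sub>R (norm q *\<^sub>R p + norm p *\<^sub>R q)"
      have "p \<bullet> ?v = t * (norm p * s)" "q \<bullet> ?v = t * (norm q * s)"
        by (simp_all add: s_def inner_add_right inner_commute dot_square_norm
            power2_eq_square algebra_simps)
      moreover have "c \<le> t * (norm p * s)" "d \<le> t * (norm q * s)"
        using 3 \<open>s > 0\<close> by (auto simp: t_def simp flip: pos_divide_le_eq)
      ultimately show ?thesis by metis
    qed
  qed
qed

lemma icbf_r_eq_0: "icbf_b h p = 0 \<Longrightarrow> icbf_r h \<mu> \<sigma> p = 0"
  by (simp add: icbf_r_def)

theorem proposition1:
  fixes f :: "(real ^ 'n) \<times> (real ^ 'm) \<Rightarrow> real ^ 'n"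
    and \<phi> :: "(real ^ 'n) \<times> (real ^ 'm) \<Rightarrow> real ^ 'm"
    and h_x :: "real ^ 'n \<Rightarrow> real"
    and h_u :: "real ^ 'm \<Rightarrow> real"
    and h_e H_u :: "(real ^ 'n) \<times> (real ^ 'm) \<Rightarrow> real"
    and \<alpha>_x \<alpha>_e \<alpha>_u \<mu>_e \<mu>_u \<sigma>_e \<sigma>_u :: "real \<Rightarrow> real"
    and D_x D_e D_u :: "real set"
  assumes "continuously_differentiable f" and "continuously_differentiable \<phi>"
    and "continuously_differentiable h_x" and "continuously_differentiable h_u"
    and "ext_class_K_on D_x \<alpha>_x" and "\<And>x. h_x x \<in> D_x"
    and "h_e = icbf_h_e f h_x \<alpha>_x" and "continuously_differentiable h_e"
    and "H_u = (\<lambda>(x, u). h_u u)"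
    and "ext_class_K_on D_e \<alpha>_e" and "\<And>p. h_e p \<in> D_e"
    and "ext_class_K_on D_u \<alpha>_u" and "\<And>u. h_u u \<in> D_u"
    and "continuously_differentiable \<mu>_e" and "antimono \<mu>_e" and "\<And>s. \<mu>_e s > 0"
    and "continuously_differentiable \<mu>_u" and "antimono \<mu>_u" and "\<And>s. \<mu>_u s > 0"
    and "continuously_differentiable \<sigma>_e" and "antimono \<sigma>_e" and "\<And>s. \<sigma>_e s > 0"
    and "continuously_differentiable \<sigma>_u" and "antimono \<sigma>_u" and "\<And>s. \<sigma>_u s > 0"
  shows
    "(compatible_robust_icbf_pair f \<phi> \<alpha>_e \<mu>_e \<sigma>_e \<alpha>_u \<mu>_u \<sigma>_u h_e H_u \<and>
      (\<forall>x_p u. feasible (icbf_qp f \<phi> \<alpha>_e \<mu>_e \<sigma>_e \<alpha>_u \<mu>_u \<sigma>_u h_e H_u (x_p, u))))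
     \<longleftrightarrow>
     (\<forall>x_p u.
        let b_e = icbf_b h_e (x_p, u); a_e = icbf_a f \<phi> h_e \<alpha>_e (x_p, u);
            r_e = icbf_r h_e \<mu>_e \<sigma>_e (x_p, u);
            b_u = icbf_b H_u (x_p, u); a_u = icbf_a f \<phi> H_u \<alpha>_u (x_p, u);
            r_u = icbf_r H_u \<mu>_u \<sigma>_u (x_p, u)
        in (b_e = 0 \<longrightarrow> a_e \<le> 0) \<and>
           (b_u = 0 \<longrightarrow> a_u \<le> 0) \<and>
           (norm b_e * norm b_u + b_e \<bullet> b_u = 0 \<longrightarrow>
              (a_e + r_e) * norm b_u + (a_u + r_u) * norm b_e \<le> 0))"
  \<comment> \<open>Both conjuncts on the left unfold to the same pointwise claim, with offsets
    \<open>a_i + r_i\<close>.\<close>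
  unfolding compatible_robust_icbf_pair_def feasible_def icbf_qp_def Let_def
    two_halfspaces_intersect_iff snd_conv mem_Collect_eq split_paired_All
  by (auto simp: icbf_r_eq_0)

end
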